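(* Let $m\geqslant 0$ be an integer, let $\alpha=(\mathcal{F}_{m+i})_{i\geqslant 0}$, and let $\tilde{\alpha}=(\tilde{\alpha}_i)_{i\geqslant 0}$ with $\tilde{\alpha}_i=(-1)^i\alpha_i$. Then for all integers $n\geqslant 0$, $$\det T_{\tilde{\alpha},\alpha}(n)=\mathcal{L}_m^{\,n-1}\mathcal{F}_{2m+n}=(\mathcal{F}_{m-1}+\mathcal{F}_{m+1})^{n-1}\mathcal{F}_{2m+n}.$$ In particular: (1) if $m=0$, then $\det T_{\tilde{\mathcal{F}},\mathcal{F}}(n)=2^{n-1}\mathcal{F}_n$, where $\mathcal{F}=(\mathcal{F}_i)_{i\geqslant 0}$ and $\tilde{\mathcal{F}}=((-1)^i\mathcal{F}_i)_{i\geqslant 0}$; (2) if $m=1$, then $\det T_{\tilde{\alpha},\alpha}(n)=\mathcal{F}_{n+2}$.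
   Context: $\mathcal{F}_n$ is the $n$th Fibonacci number: $\mathcal{F}_0=0$, $\mathcal{F}_1=1$, $\mathcal{F}_n=\mathcal{F}_{n-1}+\mathcal{F}_{n-2}$ for $n\geqslant 2$, with the convention $\mathcal{F}_{-1}=1$. $\mathcal{L}_n$ is the $n$th Lucas number: $\mathcal{L}_0=2$, $\mathcal{L}_1=1$, $\mathcal{L}_n=\mathcal{L}_{n-1}+\mathcal{L}_{n-2}$ for $n\geqslant 2$. For sequences $\alpha,\beta$ with $\alpha_0=\beta_0$, $T_{\alpha,\beta}(n)=[T_{i,j}]_{0\leqslant i,j\leqslant n}$ is the Toeplitz matrix of order $n+1$ with first column $T_{i,0}=\alpha_i$ and first row $T_{0,i}=\beta_i$ ($0\leqslant i\leqslant n$), and $T_{i,j}=T_{k,l}$ whenever $i-j=k-l$. For $n=0$ the exponent $n-1$ equals $-1$, and the formulas are identities of rational numbers. *)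

theory Defs
  imports "HOL-Number_Theory.Fib" "Jordan_Normal_Form.Determinant"
begin

(* The library's fib, extended to the index -1 by F_{-1} = 1;
   indices below -1 are not meaningful here. *)
definition fib_ext :: "int \<Rightarrow> nat" where
  "fib_ext k = (if k = -1 then 1 else fib (nat k))"

fun lucas :: "nat \<Rightarrow> nat" where
  "lucas 0 = 2"
| "lucas (Suc 0) = 1"
| "lucas (Suc (Suc n)) = lucas (Suc n) + lucas n"

(* Order n + 1; first column a, first row b. Meant for a 0 = b 0, as in toeplitz_unique;
   otherwise the diagonal is a 0. *)
definition toeplitz :: "(nat \<Rightarrow> 'a) \<Rightarrow> (nat \<Rightarrow> 'a) \<Rightarrow> nat \<Rightarrow> 'a mat" where
  "toeplitz a b n =
     mat (n + 1) (n + 1) (\<lambda>(i, j). if j \<le> i then a (i - j) else b (j - i))"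

definition alternate :: "(nat \<Rightarrow> 'a::ring_1) \<Rightarrow> nat \<Rightarrow> 'a" where
  "alternate a = (\<lambda>i. (-1) ^ i * a i)"

lemma toeplitz_unique:
  assumes "a 0 = b 0"
  shows "T = toeplitz a b n \<longleftrightarrow>
    T \<in> carrier_mat (n + 1) (n + 1) \<and>
    (\<forall>i\<le>n. T $$ (i, 0) = a i \<and> T $$ (0, i) = b i) \<and>
    (\<forall>i\<le>n. \<forall>j\<le>n. \<forall>k\<le>n. \<forall>l\<le>n.
       int i - int j = int k - int l \<longrightarrow> T $$ (i, j) = T $$ (k, l))"
    (is "_ \<longleftrightarrow> ?C \<and> ?B \<and> ?D")
proof
  assume T: "T = toeplitz a b n"
  have idx: "T $$ (i, j) = (if j \<le> i then a (i - j) else b (j - i))"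
    if "i \<le> n" "j \<le> n" for i j
    using that by (simp add: T toeplitz_def)
  have "T $$ (i, j) = T $$ (k, l)"
    if "i \<le> n" "j \<le> n" "k \<le> n" "l \<le> n" and e: "int i - int j = int k - int l" for i j k l
  proof -
    have "i + l = k + j" using e by linarith
    then have "i - j = k - l" "j - i = l - k" "j \<le> i \<longleftrightarrow> l \<le> k" by arith+
    then show ?thesis using that by (simp only: idx)
  qed
  then have ?D by blast
  moreover have ?B using assms by (simp add: idx)
  moreover have ?C by (simp add: T toeplitz_def)
  ultimately show "?C \<and> ?B \<and> ?D" by (intro conjI)
next
  assume R: "?C \<and> ?B \<and> ?D"
  note C = R[THEN conjunct1] and B = R[THEN conjunct2, THEN conjunct1]
    and D = R[THEN conjunct2, THEN conjunct2]
  have "T $$ (i, j) = (if j \<le> i then a (i - j) else b (j - i))"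
    if "i \<le> n" "j \<le> n" for i j
  proof (cases "j \<le> i")
    case True
    then have "T $$ (i, j) = T $$ (i - j, 0)"
      using that by (intro D[rule_format]) simp_all
    then show ?thesis using B True that by simp
  next
    case False
    then have "T $$ (i, j) = T $$ (0, j - i)"
      using that by (intro D[rule_format]) simp_all
    then show ?thesis using B False that by simp
  qed
  then show "T = toeplitz a b n"
    using C by (intro eq_matI) (simp_all add: toeplitz_def)
qed

end

theory Submission
  imports Defs
begin

text \<open>Subtracting from each column $j \geq 2$ the two preceding columns leaves all columns but
  the first two with a single entry, in row $j - 1$: the Fibonacci recurrence kills the entries
  above it and, because of the alternating signs, also those below.
  Expanding along these columns reduces the determinant to the minor formed by the first and
  last rows of the first two columns, which the addition formula for Fibonacci numbers evaluates.\<close>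

text \<open>Induction by expansion along the last column: its single entry \<open>c\<close> lies
  just above the diagonal, so each step contributes the factor \<open>- c\<close>.\<close>

lemma det_shifted_scalar_columns:
  fixes c :: "'a::comm_ring_1"
  shows "det (mat (n + 2) (n + 2)
      (\<lambda>(i, j). if j = 0 then u i else if j = 1 then v i else if i + 1 = j then c else 0))
    = (- c) ^ n * (u 0 * v (n + 1) - v 0 * u (n + 1))"
proof (induction n arbitrary: u v)
  case 0
  show ?case by (subst laplace_expansion_column[where j = 0])
      (auto simp: numeral_2_eq_2 cofactor_def mat_delete_def det_single algebra_simps)
next
  case (Suc n)
  define M where "M = (\<lambda>n u v. mat (n + 2) (n + 2)
      (\<lambda>(i, j). if j = 0 then u i else if j = 1 then v i else if i + 1 = j then c else (0::'a)))"
  \<comment> \<open>Expanding deletes the last row but one, so the bottom entries of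
    \<open>u\<close> and \<open>v\<close> survive every step. The columns change, hence the
    induction over arbitrary \<open>u\<close> and \<open>v\<close>.\<close>
  define skip where "skip = (\<lambda>u i. if i < n + 1 then u i else u (i + 1) :: 'a)"
  have minor: "mat_delete (M (Suc n) u v) (n + 1) (n + 2) = M n (skip u) (skip v)"
    by (rule eq_matI) (auto simp: mat_delete_def M_def skip_def)
  have "det (M (Suc n) u v)
      = (\<Sum>i<n + 3. M (Suc n) u v $$ (i, n + 2) * cofactor (M (Suc n) u v) i (n + 2))"
    by (rule laplace_expansion_column) (auto simp: M_def)
  also have "\<dots> = (\<Sum>i<n + 3. if i = n + 1 then c * cofactor (M (Suc n) u v) i (n + 2) else 0)"
    by (rule sum.cong) (auto simp: M_def)
  also have "\<dots> = c * cofactor (M (Suc n) u v) (n + 1) (n + 2)"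
    by (simp add: sum.delta)
  also have "\<dots> = - c * det (M n (skip u) (skip v))"
    by (simp only: cofactor_def minor) simp
  also have "det (M n (skip u) (skip v)) = (- c) ^ n * (u 0 * v (n + 2) - v 0 * u (n + 2))"
    unfolding M_def Suc.IH by (simp add: skip_def)
  finally show ?case by (simp add: M_def mult.assoc)
qed

text \<open>The order is \<open>n + 2\<close>, which guarantees that both untouched columns exist
  and keeps the exponent a natural number.\<close>

lemma det_toeplitz_alternate_fib_recurrence:
  fixes a :: "nat \<Rightarrow> 'a::idom"
  assumes rec: "\<And>i. a (i + 2) = a (i + 1) + a i"
  shows "det (toeplitz (alternate a) a (n + 1))
    = (2 * a 1 - a 0) ^ n * (a 0 * a n + a 1 * a (n + 1))"
proof -
  define c where "c = 2 * a 1 - a 0"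
  define b where "b = alternate a"
  define t where "t = (\<lambda>i j. if j \<le> i then b (i - j) else a (j - i))"
  define T where "T = toeplitz b a (n + 1)"
  \<comment> \<open>Right multiplication by \<open>U\<close> performs the column operations. The
    test \<open>2 \<le> j\<close> protects column 1 from losing column 0; \<open>k + 2 = j\<close>
    already forces it.\<close>
  define U where "U = mat (n + 2) (n + 2) (\<lambda>(k, j). (if k = j then 1 else 0)
      - (if k + 1 = j then if 2 \<le> j then 1 else 0 else 0)
      - (if k + 2 = j then 1 else (0::'a)))"
  define M where "M = mat (n + 2) (n + 2) (\<lambda>(i, j).
      if j = 0 then b i else if j = 1 then t i 1 else if i + 1 = j then c else 0)"
  have T: "T \<in> carrier_mat (n + 2) (n + 2)" and U: "U \<in> carrier_mat (n + 2) (n + 2)"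
    by (auto simp: T_def toeplitz_def U_def)
  \<comment> \<open>The alternating signs reverse the recurrence, which is the direction needed
    below the diagonal, where the index \<open>i - j\<close> falls as \<open>j\<close>
    grows.\<close>
  have b_rec: "b i = b (i + 1) + b (i + 2)" for i
    by (simp add: b_def alternate_def rec[simplified] algebra_simps)
  have b0: "b 0 = a 0" "b 1 = - a 1"
    by (simp_all add: b_def alternate_def)
  \<comment> \<open>Three neighbouring entries of a row all come from \<open>b\<close> or all from
    \<open>a\<close> (using \<open>b 0 = a 0\<close>), except for \<open>i = j + 1\<close>: there
    they are \<open>b 1 = - a 1\<close>, \<open>a 0\<close>, \<open>a 1\<close>, and
    \<open>a 1 - a 0 + a 1 = c\<close>.\<close>
  have t_rec: "t i (j + 2) - t i (j + 1) - t i j = (if i = j + 1 then c else 0)" for i j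
  proof -
    consider k where "i = j + 2 + k" | "i = j + 1" | k where "j = i + k"
      by (metis Suc_eq_plus1 add_2_eq_Suc' le_Suc_ex not_less_eq_eq
          le_antisym nat_le_linear)
    then show ?thesis
    proof cases
      case 1
      then show ?thesis using b_rec[of k] by (simp add: t_def)
    next
      case 2
      then show ?thesis using b0 by (simp add: t_def c_def)
    next
      case 3
      then show ?thesis using b0 rec[of k] by (cases k) (auto simp: t_def numeral_2_eq_2 numeral_3_eq_3)
    qed
  qed
  have "T * U = M"
  proof (rule eq_matI)
    fix i j assume "i < dim_row M" "j < dim_col M"
    then have ij: "i < n + 2" "j < n + 2" by (auto simp: M_def)
    have "(T * U) $$ (i, j) = (\<Sum>k<n + 2. t i k * U $$ (k, j))"
      using ij by (auto simp: T_def U_def toeplitz_def t_def scalar_prod_def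
          atLeast0LessThan intro!: sum.cong)
    \<comment> \<open>Solving for \<open>k\<close> prepares \<open>sum.delta\<close>; the tests
      \<open>2 \<le> j\<close> discard the columns where the truncated differences would give wrong
      indices.\<close>
    also have "\<dots> = (\<Sum>k<n + 2. (if k = j then t i k else 0)
        - (if k = j - 1 then if 2 \<le> j then t i k else 0 else 0)
        - (if k = j - 2 then if 2 \<le> j then t i k else 0 else 0))"
      using ij by (intro sum.cong refl) (auto simp: U_def)
    also have "\<dots> = t i j - (if 2 \<le> j then t i (j - 1) else 0) - (if 2 \<le> j then t i (j - 2) else 0)"
      using ij by (auto simp: sum_subtractf sum.delta simp del: sum.lessThan_Suc)
    also have "\<dots> = M $$ (i, j)"
    proof (cases "2 \<le> j")
      case True
      then obtain l where "j = l + 2" by (metis add.commute le_Suc_ex)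
      then show ?thesis using ij t_rec[of i l] by (simp add: M_def)
    next
      case False
      then consider "j = 0" | "j = 1" by linarith
      then show ?thesis using ij by cases (simp_all add: M_def t_def)
    qed
    finally show "(T * U) $$ (i, j) = M $$ (i, j)" .
  qed (auto simp: T_def toeplitz_def U_def M_def)
  moreover have "det U = 1"
  proof -
    have "upper_triangular U"
      by (auto simp: upper_triangular_def U_def)
    then have "det U = (\<Prod>i = 0..<n + 2. U $$ (i, i))"
      using U by (simp add: det_upper_triangular prod_list_diag_prod)
    also have "\<dots> = 1"
      by (rule prod.neutral) (simp add: U_def)
    finally show ?thesis .
  qed
  ultimately have "det T = det M"
    using det_mult[OF T U] by simp
  also have "\<dots> = (- c) ^ n * (b 0 * t (n + 1) 1 - t 0 1 * b (n + 1))"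
    unfolding M_def by (rule det_shifted_scalar_columns)
  \<comment> \<open>Here \<open>t (n + 1) 1 = b n\<close> and \<open>t 0 1 = a 1\<close>; the sign
    of \<open>b (n + 1)\<close> turns the difference into a sum, and the remaining
    \<open>(- 1) ^ n\<close> cancels that of \<open>(- c) ^ n\<close>.\<close>
  also have "\<dots> = (- c) ^ n * ((- 1) ^ n * (a 0 * a n + a 1 * a (n + 1)))"
    by (simp add: t_def b_def alternate_def algebra_simps)
  also have "\<dots> = c ^ n * (a 0 * a n + a 1 * a (n + 1))"
    by (simp flip: mult.assoc power_mult_distrib)
  finally show ?thesis
    by (simp add: T_def b_def c_def)
qed

lemma lucas_Suc_eq_fib: "lucas (Suc m) = fib m + fib (m + 2)"
  by (induction m rule: fib.induct) auto

text \<open>Identifies the constant \<open>2 * a 1 - a 0\<close> as \<open>lucas m\<close> when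
  \<open>a i = fib (m + i)\<close>.\<close>

lemma lucas_add_fib: "lucas m + fib m = 2 * fib (m + 1)"
  by (cases m) (auto simp: lucas_Suc_eq_fib)

lemma lucas_eq_fib_ext: "lucas m = fib_ext (int m - 1) + fib_ext (int m + 1)"
  by (cases m) (auto simp: lucas_Suc_eq_fib fib_ext_def nat_add_distrib)

lemma lucas_pos: "lucas m > 0"
  by (induction m rule: lucas.induct) auto

text \<open>Serves the case \<open>n = 0\<close>, where the exponent is -1 and the determinant is
  the single entry \<open>fib m\<close>.\<close>

lemma lucas_mult_fib: "lucas m * fib m = fib (2 * m)"
proof (cases m)
  case (Suc k)
  then show ?thesis
    using fib_add[of k "Suc k"] by (simp add: lucas_Suc_eq_fib algebra_simps mult_2 mult_2_right)
qed simp

text \<open>Evaluates the factor \<open>a 0 * a n + a 1 * a (n + 1)\<close> for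
  \<open>a i = fib (m + i)\<close>.\<close>

lemma fib_double_add: "fib m * fib (m + n) + fib (m + 1) * fib (m + n + 1) = fib (2 * m + n + 1)"
  using fib_add[of "m + n" m] by (simp add: algebra_simps mult_2 mult_2_right)

lemma det_toeplitz_fib_shift:
  "det (toeplitz (alternate (\<lambda>i. of_nat (fib (m + i)) :: rat)) (\<lambda>i. of_nat (fib (m + i))) n)
    = of_nat (lucas m) powi (int n - 1) * of_nat (fib (2 * m + n))"
proof (cases n)
  case 0
  have "of_nat (lucas m) * of_nat (fib m) = (of_nat (fib (2 * m)) :: rat)"
    by (simp only: lucas_mult_fib flip: of_nat_mult)
  moreover have "(of_nat (lucas m) :: rat) \<noteq> 0"
    using lucas_pos[of m] by simp
  ultimately show ?thesis
    using 0 by (simp add: det_single toeplitz_def alternate_def power_int_minus field_simps)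
next
  case (Suc k)
  have "of_nat (lucas m) + of_nat (fib m) = (2 * of_nat (fib (m + 1)) :: rat)"
    using arg_cong[OF lucas_add_fib[of m], of "of_nat :: nat \<Rightarrow> rat"] by simp
  then have lucas: "2 * of_nat (fib (m + 1)) - of_nat (fib (m + 0)) = (of_nat (lucas m) :: rat)"
    by (simp add: algebra_simps)
  have fib: "of_nat (fib (m + 0)) * of_nat (fib (m + k))
      + of_nat (fib (m + 1)) * of_nat (fib (m + (k + 1))) = (of_nat (fib (2 * m + n)) :: rat)"
    using arg_cong[OF fib_double_add[of m k], of "of_nat :: nat \<Rightarrow> rat"] Suc by simp
  show ?thesis
    using det_toeplitz_alternate_fib_recurrence[of "\<lambda>i. of_nat (fib (m + i)) :: rat" k]
    unfolding lucas fib by (simp add: Suc)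
qed

theorem corollary2:
  "(\<forall>(m::nat) (n::nat).
      let \<alpha> = (\<lambda>i. of_nat (fib (m + i)) :: rat) in
        det (toeplitz (alternate \<alpha>) \<alpha> n)
          = of_nat (lucas m) powi (int n - 1) * of_nat (fib (2 * m + n))
      \<and> of_nat (lucas m) powi (int n - 1) * of_nat (fib (2 * m + n))
          = (of_nat (fib_ext (int m - 1)) + of_nat (fib_ext (int m + 1)) :: rat) powi (int n - 1)
            * of_nat (fib (2 * m + n)))
   \<and> (\<forall>n::nat.
      let \<F> = (\<lambda>i. of_nat (fib i) :: rat) in
        det (toeplitz (alternate \<F>) \<F> n) = 2 powi (int n - 1) * of_nat (fib n))
   \<and> (\<forall>n::nat.
      let \<alpha> = (\<lambda>i. of_nat (fib (1 + i)) :: rat) in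
        det (toeplitz (alternate \<alpha>) \<alpha> n) = of_nat (fib (n + 2)))"
proof (intro conjI allI)
  fix m n :: nat
  show "let \<alpha> = (\<lambda>i. of_nat (fib (m + i)) :: rat) in
        det (toeplitz (alternate \<alpha>) \<alpha> n)
          = of_nat (lucas m) powi (int n - 1) * of_nat (fib (2 * m + n))
      \<and> of_nat (lucas m) powi (int n - 1) * of_nat (fib (2 * m + n))
          = (of_nat (fib_ext (int m - 1)) + of_nat (fib_ext (int m + 1)) :: rat) powi (int n - 1)
            * of_nat (fib (2 * m + n))"
    by (simp add: Let_def det_toeplitz_fib_shift lucas_eq_fib_ext)
next
  fix n :: nat
  show "let \<F> = (\<lambda>i. of_nat (fib i) :: rat) in
        det (toeplitz (alternate \<F>) \<F> n) = 2 powi (int n - 1) * of_nat (fib n)"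
    using det_toeplitz_fib_shift[of 0 n] by simp
next
  fix n :: nat
  show "let \<alpha> = (\<lambda>i. of_nat (fib (1 + i)) :: rat) in
        det (toeplitz (alternate \<alpha>) \<alpha> n) = of_nat (fib (n + 2))"
    using det_toeplitz_fib_shift[of 1 n] by simp
qed

end
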